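(* Let $\mathbf{p}(t)$ be a non-degenerate planar rational cubic Bézier curve with control points $\mathbf{c}_0,\dots,\mathbf{c}_3\in\mathbb{R}^2$, no three of which are collinear, and non-zero real weights $w_0,\dots,w_3$. Let $\Phi_1=\phi_1u_2u_3$, $\Phi_2=\phi_2u_0u_1$, $\Phi_3=\phi_3u_1u_2$, and assume $\Phi_1+\Phi_2-\Phi_3\neq0$ (so that the parameter values of the double point are finite). Then there exists an unwanted singularity in the region of interest if and only if $\Phi_1\Phi_2<0$.
   Context: For $\mathbf{c}_i=(c_{i,0},c_{i,1})\in\mathbb{R}^2$ and real weights $w_i$ ($i=0,1,2,3$), the rational cubic Bézier curve is $$\mathbf{p}(t)=\frac{\mathbf{c}_0w_0(1-t)^3+3\mathbf{c}_1w_1(1-t)^2t+3\mathbf{c}_2w_2(1-t)t^2+\mathbf{c}_3w_3t^3}{w_0(1-t)^3+3w_1(1-t)^2t+3w_2(1-t)t^2+w_3t^3},$$ and $u_i=\binom{3}{i}w_i$. The region of interest is the parameter interval $[0,1]$. $\lambda_{ijk}=\begin{vmatrix}c_{i,0}&c_{i,1}&1\\c_{j,0}&c_{j,1}&1\\c_{k,0}&c_{k,1}&1\end{vmatrix}$, and $\lambda_0=\lambda_{321}$, $\lambda_1=\lambda_{230}$, $\lambda_2=\lambda_{103}$, $\lambda_3=\lambda_{012}$. Further $$\phi_1=u_0u_2\lambda_1^2-u_1^2\lambda_0\lambda_2,\quad\phi_2=u_1u_3\lambda_2^2-u_2^2\lambda_1\lambda_3,\quad\phi_3=u_1u_2\lambda_0\lambda_3-u_0u_3\lambda_1\lambda_2.$$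 The curve is non-degenerate if it does not degenerate to a conic section or a line, i.e. no nonzero polynomial in $x,y$ of total degree at most $2$ vanishes identically on $\mathbf{p}(t)$. A non-degenerate curve is a cubic with exactly one singular point in the projective plane, its double point. The parameter values of the double point are the two values of $t$ (real or complex, counted with multiplicity, possibly infinite) which the parametrization, extended to the projective line and projective plane, sends to the double point. An unwanted singularity (unwanted self-intersection) is the case where one of the two parameter values of the double point lies within the interval $[0,1]$ and the other lies outside $[0,1]$. A singularity with an infinite parameter value is not classified as unwanted.
   Formalization: "Within [0,1]" is read as the open interval (0,1) for the inner parameter value; if a double-point value is 0 or 1 and the other lies outside [0,1], then Φ1Φ2=0 and the criterion with the closed interval fails (e.g. unit square, weights 1, 1/3, 2/3, 4). *)

theory Defs
  imports "HOL-Analysis.Analysis"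
begin

text \<open>Control points \<open>c 0, \<dots>, c 3\<close> and weights \<open>w 0, \<dots>, w 3\<close>; other indices are never used.\<close>

definition bezier_u :: "(nat \<Rightarrow> real) \<Rightarrow> nat \<Rightarrow> real" where
  "bezier_u w i = real (3 choose i) * w i"

definition bezier_denom :: "(nat \<Rightarrow> real) \<Rightarrow> real \<Rightarrow> real" where
  "bezier_denom w t = (\<Sum>i\<le>3. bezier_u w i * (1 - t) ^ (3 - i) * t ^ i)"

definition bezier_curve :: "(nat \<Rightarrow> real \<times> real) \<Rightarrow> (nat \<Rightarrow> real) \<Rightarrow> real \<Rightarrow> real \<times> real" where
  "bezier_curve c w t =
     (\<Sum>i\<le>3. (bezier_u w i * (1 - t) ^ (3 - i) * t ^ i) *\<^sub>R c i) /\<^sub>R bezier_denom w t"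

text \<open>\<open>a i j\<close> is the coefficient of \<open>x ^ i * y ^ j\<close> in a polynomial of total degree at most 2.
  Zeros of the denominator are points at infinity of the curve and are left out.\<close>

definition nondegenerate :: "(nat \<Rightarrow> real \<times> real) \<Rightarrow> (nat \<Rightarrow> real) \<Rightarrow> bool" where
  "nondegenerate c w \<longleftrightarrow>
     \<not> (\<exists>a :: nat \<Rightarrow> nat \<Rightarrow> real. (\<exists>i j. i + j \<le> 2 \<and> a i j \<noteq> 0) \<and>
          (\<forall>t. bezier_denom w t \<noteq> 0 \<longrightarrow>
            (\<Sum>i\<le>2. \<Sum>j\<le>2 - i. a i j * fst (bezier_curve c w t) ^ i * snd (bezier_curve c w t) ^ j) = 0))"

definition lam3 :: "(nat \<Rightarrow> real \<times> real) \<Rightarrow> nat \<Rightarrow> nat \<Rightarrow> nat \<Rightarrow> real" where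
  "lam3 c i j k = det (vector [vector [fst (c i), snd (c i), 1],
                               vector [fst (c j), snd (c j), 1],
                               vector [fst (c k), snd (c k), 1]] :: real ^ 3 ^ 3)"

definition lam :: "(nat \<Rightarrow> real \<times> real) \<Rightarrow> nat \<Rightarrow> real" where
  "lam c i = (if i = 0 then lam3 c 3 2 1 else if i = 1 then lam3 c 2 3 0
              else if i = 2 then lam3 c 1 0 3 else lam3 c 0 1 2)"

definition phi1 :: "(nat \<Rightarrow> real \<times> real) \<Rightarrow> (nat \<Rightarrow> real) \<Rightarrow> real" where
  "phi1 c w = bezier_u w 0 * bezier_u w 2 * (lam c 1)\<^sup>2 - (bezier_u w 1)\<^sup>2 * lam c 0 * lam c 2"

definition phi2 :: "(nat \<Rightarrow> real \<times> real) \<Rightarrow> (nat \<Rightarrow> real) \<Rightarrow> real" where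
  "phi2 c w = bezier_u w 1 * bezier_u w 3 * (lam c 2)\<^sup>2 - (bezier_u w 2)\<^sup>2 * lam c 1 * lam c 3"

definition phi3 :: "(nat \<Rightarrow> real \<times> real) \<Rightarrow> (nat \<Rightarrow> real) \<Rightarrow> real" where
  "phi3 c w = bezier_u w 1 * bezier_u w 2 * lam c 0 * lam c 3
            - bezier_u w 0 * bezier_u w 3 * lam c 1 * lam c 2"

definition Phi1 :: "(nat \<Rightarrow> real \<times> real) \<Rightarrow> (nat \<Rightarrow> real) \<Rightarrow> real" where
  "Phi1 c w = phi1 c w * bezier_u w 2 * bezier_u w 3"

definition Phi2 :: "(nat \<Rightarrow> real \<times> real) \<Rightarrow> (nat \<Rightarrow> real) \<Rightarrow> real" where
  "Phi2 c w = phi2 c w * bezier_u w 0 * bezier_u w 1"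

definition Phi3 :: "(nat \<Rightarrow> real \<times> real) \<Rightarrow> (nat \<Rightarrow> real) \<Rightarrow> real" where
  "Phi3 c w = phi3 c w * bezier_u w 1 * bezier_u w 2"

text \<open>Homogeneous coordinates of the curve point at a finite complex parameter. Points of the
  complex projective plane are nonzero vectors up to a nonzero scalar.\<close>

definition bezier_proj :: "(nat \<Rightarrow> real \<times> real) \<Rightarrow> (nat \<Rightarrow> real) \<Rightarrow> complex \<Rightarrow> complex ^ 3" where
  "bezier_proj c w t =
     (\<Sum>i\<le>3. (of_real (bezier_u w i) * (1 - t) ^ (3 - i) * t ^ i) *s
        vector [of_real (fst (c i)), of_real (snd (c i)), 1])"

definition same_point :: "complex ^ 3 \<Rightarrow> complex ^ 3 \<Rightarrow> bool" where
  "same_point P Q \<longleftrightarrow> (\<exists>k. k \<noteq> 0 \<and> P = k *s Q)"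

text \<open>\<open>f i j\<close> is the coefficient of \<open>x ^ i * y ^ j * z ^ (3 - i - j)\<close> in a ternary cubic form.\<close>

definition cubic_form :: "(nat \<Rightarrow> nat \<Rightarrow> complex) \<Rightarrow> complex ^ 3 \<Rightarrow> complex" where
  "cubic_form f v = (\<Sum>i\<le>3. \<Sum>j\<le>3 - i. f i j * v $ 1 ^ i * v $ 2 ^ j * v $ 3 ^ (3 - i - j))"

definition cubic_equation ::
    "(nat \<Rightarrow> real \<times> real) \<Rightarrow> (nat \<Rightarrow> real) \<Rightarrow> (nat \<Rightarrow> nat \<Rightarrow> complex) \<Rightarrow> bool" where
  "cubic_equation c w f \<longleftrightarrow>
     (\<exists>i j. i + j \<le> 3 \<and> f i j \<noteq> 0) \<and> (\<forall>t. cubic_form f (bezier_proj c w t) = 0)"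

text \<open>A singular point of the projective cubic: a point where all partial derivatives of its
  equation vanish (by Euler's identity it then lies on the cubic). The equation of a non-degenerate
  curve is unique up to a factor, so it does not matter which one is taken.\<close>

definition double_point :: "(nat \<Rightarrow> real \<times> real) \<Rightarrow> (nat \<Rightarrow> real) \<Rightarrow> complex ^ 3 \<Rightarrow> bool" where
  "double_point c w Q \<longleftrightarrow> Q \<noteq> 0 \<and>
     (\<exists>f. cubic_equation c w f \<and>
       (\<forall>k. ((\<lambda>z. cubic_form f (Q + z *s axis k 1)) has_field_derivative 0) (at 0)))"

text \<open>The two parameter values of the double point are \<open>t1\<close> and \<open>t2\<close>, both finite; being distinct,
  each has multiplicity one, and the infinite parameter is not a further value. The value
  \<open>t2\<close> outside \<open>[0,1]\<close> may a priori be non-real. Lying within \<open>[0,1]\<close> is read as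
  lying in the interior: a double point at an end point of the segment does not count. With
  \<open>t1\<close> allowed to be 0 or 1 the criterion \<open>Phi1 * Phi2 < 0\<close> would fail, for instance for the unit
  square \<open>(0,0), (0,1), (1,1), (1,0)\<close> with weights \<open>1, 1/3, 2/3, 4\<close>, where the values are
  0 and -1 and \<open>Phi2 = 0\<close>.\<close>

definition unwanted_singularity :: "(nat \<Rightarrow> real \<times> real) \<Rightarrow> (nat \<Rightarrow> real) \<Rightarrow> bool" where
  "unwanted_singularity c w \<longleftrightarrow>
     (\<exists>Q t1 t2. double_point c w Q \<and>
        {t. same_point (bezier_proj c w t) Q} = {complex_of_real t1, t2} \<and>
        t1 \<in> {0<..<1} \<and> t2 \<notin> complex_of_real ` {0..1})"

end

theory Submission
  imports Defs
begin

text \<open>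
  In homogeneous coordinates the curve is the image of the monomial curve
  \<open>v(t) = ((1-t)^3, (1-t)^2 t, (1-t) t^2, t^3)\<close> under the linear map from 4-space to 3-space that
  sends the \<open>i\<close>-th unit vector to \<open>u\<^sub>i\<close> times the \<open>i\<close>-th control point. The determinants
  \<open>\<lambda>\<^sub>i\<close> are the coefficients of the linear relation between the control points, so the kernel of
  the map is the line spanned by \<open>m = (\<lambda>\<^sub>i / u\<^sub>i)\<^sub>i\<close>
  (\<open>lam_control_vec\<close>, \<open>control_vec_relation_unique\<close>). Hence, if \<open>m\<close> is
  not itself a multiple of a point of the monomial curve, two parameters \<open>t \<noteq> t'\<close> have the same image exactly when \<open>m\<close> lies on the secant of the monomial
  curve through \<open>v(t)\<close> and \<open>v(t')\<close>, and that happens when \<open>m\<close> satisfies the linear recurrence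
  with characteristic roots \<open>t/(1-t)\<close> and \<open>t'/(1-t')\<close>. The three numbers \<open>\<Phi>\<close> are, up to one
  common factor, the \<open>2 \<times> 2\<close> minors of the Hankel matrix of \<open>m\<close>, that is, the coefficients of
  this recurrence. So the parameters of the double point are the roots of
    \<open>q(t) = \<Phi>\<^sub>1 t^2 + \<Phi>\<^sub>3 t (1-t) + \<Phi>\<^sub>2 (1-t)^2\<close>,
  whose leading coefficient is \<open>L = \<Phi>\<^sub>1 + \<Phi>\<^sub>2 - \<Phi>\<^sub>3\<close>; equivalently
  \<open>\<Phi>\<^sub>1 = L (1-t)(1-t')\<close> and \<open>\<Phi>\<^sub>2 = L t t'\<close>
  (\<open>dependent_points_params\<close>, with converse \<open>dependent_points_exist\<close>).

  Since \<open>q(0) = \<Phi>\<^sub>2\<close> and \<open>q(1) = \<Phi>\<^sub>1\<close>, the condition \<open>\<Phi>\<^sub>1 \<Phi>\<^sub>2 < 0\<close> says that \<open>q\<close> changes sign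
  on the unit interval, which for a quadratic means that one root lies inside and the other,
  necessarily real, outside.

  That the common image \<open>Q\<close> of the two roots is singular on the cubic is shown with an explicit
  equation (\<open>double_point_bezier_proj\<close>): there are two lines \<open>X = 0\<close> and \<open>Y = 0\<close> through \<open>Q\<close>
  whose forms pull back to \<open>t q(t)\<close> and \<open>(1-t) q(t)\<close> on the curve. The pencil of lines through
  \<open>Q\<close> therefore recovers the parameter, and comparing with a third form \<open>Z\<close> gives a
  cubic equation all of whose terms have degree at least 2 in \<open>(X, Y)\<close>.
\<close>

section \<open>Linear relations between the control points\<close>

lemma sum_atMost_3: "(\<Sum>i\<le>(3::nat). f i) = f 0 + f 1 + f 2 + f 3"
  by (simp add: eval_nat_numeral)

lemma all_atMost_3: "(\<forall>i\<le>(3::nat). Q i) \<longleftrightarrow> Q 0 \<and> Q 1 \<and> Q 2 \<and> Q 3"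
  by (auto simp: le_Suc_eq numeral_3_eq_3 numeral_2_eq_2)

definition control_vec :: "(nat \<Rightarrow> real \<times> real) \<Rightarrow> nat \<Rightarrow> complex ^ 3" where
  "control_vec c i = vector [of_real (fst (c i)), of_real (snd (c i)), 1]"

definition monom3 :: "nat \<Rightarrow> complex \<Rightarrow> complex" where
  "monom3 i t = (1 - t) ^ (3 - i) * t ^ i"

lemma monom3_simps:
  "monom3 0 t = (1 - t) ^ 3" "monom3 1 t = (1 - t)\<^sup>2 * t" "monom3 (Suc 0) t = (1 - t)\<^sup>2 * t"
  "monom3 2 t = (1 - t) * t\<^sup>2" "monom3 3 t = t ^ 3"
  by (simp_all add: monom3_def)

lemma bezier_proj_control_vec:
  "bezier_proj c w t = (\<Sum>i\<le>3. (of_real (bezier_u w i) * monom3 i t) *s control_vec c i)"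
  by (simp add: bezier_proj_def control_vec_def monom3_def mult.assoc)

lemma lam3_expand:
  "lam3 c i j k = fst (c i) * (snd (c j) - snd (c k)) - snd (c i) * (fst (c j) - fst (c k))
     + (fst (c j) * snd (c k) - fst (c k) * snd (c j))"
  by (simp add: lam3_def det_3 algebra_simps)

text \<open>This is Cramer's rule: any four vectors in 3-space satisfy the linear relation whose
  coefficients are their \<open>3 \<times> 3\<close> minors with alternating signs. The signs are absorbed by the order of
  the points in each \<open>lam c i\<close>.\<close>

lemma lam_control_vec: "(\<Sum>i\<le>3. of_real (lam c i) *s control_vec c i) = 0"
  by (simp add: vec_eq_iff forall_3 sum_atMost_3 control_vec_def lam_def lam3_expand)
     (simp add: algebra_simps)

lemma lam_0_nonzero:
  assumes "\<not> collinear {c 1, c 2, c 3}"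
  shows "lam c 0 \<noteq> 0"
proof
  assume z: "lam c 0 = 0"
  define p q where "p = c 2 - c 1" and "q = c 3 - c 1"
  have d: "fst p * snd q = snd p * fst q"
    using z by (simp add: p_def q_def lam_def lam3_expand algebra_simps)
  have "p = 0 \<or> (\<exists>k. q = k *\<^sub>R p)"
  proof (cases "fst p = 0")
    case True
    show ?thesis
    proof (cases "snd p = 0")
      case True
      then show ?thesis using \<open>fst p = 0\<close> by (simp add: prod_eq_iff)
    next
      case False
      then have "q = (snd q / snd p) *\<^sub>R p"
        using d \<open>fst p = 0\<close> by (simp add: prod_eq_iff)
      then show ?thesis by blast
    qed
  next
    case False
    then have "q = (fst q / fst p) *\<^sub>R p"
      using d by (auto simp: prod_eq_iff field_simps)
    then show ?thesis by blast
  qed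
  then have "collinear {0, p, q}"
    by (auto simp: collinear_lemma)
  then have "collinear {c 1, c 2, c 3}"
    using collinear_3[of "c 2" "c 1" "c 3"] by (simp add: p_def q_def insert_commute)
  then show False using assms by blast
qed

text \<open>As \<open>lam c 0\<close> is, up to sign, the determinant of the last three control vectors, these form a
  basis. Subtracting a multiple of the known relation removes the coefficient of the first vector,
  and then nothing is left.\<close>

lemma control_vec_relation_unique:
  assumes l0: "lam c 0 \<noteq> 0"
    and rel: "(\<Sum>i\<le>3. x i *s control_vec c i) = 0"
  shows "\<exists>\<mu>. \<forall>i\<le>3. x i = \<mu> * of_real (lam c i)"
proof -
  define a b where "a i = complex_of_real (fst (c i))" and "b i = complex_of_real (snd (c i))" for i
  define \<mu> where "\<mu> = x 0 / of_real (lam c 0)"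
  define y where "y i = x i - \<mu> * of_real (lam c i)" for i
  define d where "d = complex_of_real (lam c 0)"
  have d: "d = a 3 * (b 2 - b 1) - b 3 * (a 2 - a 1) + (a 2 * b 1 - a 1 * b 2)"
    by (simp add: d_def a_def b_def lam_def lam3_expand)
  have d0: "d \<noteq> 0" using l0 by (simp add: d_def)
  have y0: "y 0 = 0" using l0 by (simp add: y_def \<mu>_def)
  have "(\<Sum>i\<le>3. y i *s control_vec c i)
      = (\<Sum>i\<le>3. x i *s control_vec c i) - \<mu> *s (\<Sum>i\<le>3. of_real (lam c i) *s control_vec c i)"
    by (simp add: y_def vec_eq_iff sum_atMost_3 algebra_simps)
  then have "(\<Sum>i\<le>3. y i *s control_vec c i) = 0"
    using rel lam_control_vec[of c] by simp
  then have e: "y 1 * a 1 + y 2 * a 2 + y 3 * a 3 = 0" "y 1 * b 1 + y 2 * b 2 + y 3 * b 3 = 0"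
      "y 1 + y 2 + y 3 = 0"
    using y0 by (simp_all add: vec_eq_iff forall_3 sum_atMost_3 control_vec_def a_def b_def)
  (* the cofactors of a 3 x 3 matrix eliminate two of the three unknowns at a time *)
  have "y 1 * d = - ((y 1 * a 1 + y 2 * a 2 + y 3 * a 3) * (b 2 - b 3)
      + (y 1 * b 1 + y 2 * b 2 + y 3 * b 3) * (a 3 - a 2) + (y 1 + y 2 + y 3) * (a 2 * b 3 - a 3 * b 2))"
    unfolding d by (simp add: algebra_simps)
  moreover have "y 2 * d = - ((y 1 * a 1 + y 2 * a 2 + y 3 * a 3) * (b 3 - b 1)
      + (y 1 * b 1 + y 2 * b 2 + y 3 * b 3) * (a 1 - a 3) + (y 1 + y 2 + y 3) * (a 3 * b 1 - a 1 * b 3))"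
    unfolding d by (simp add: algebra_simps)
  moreover have "y 3 * d = - ((y 1 * a 1 + y 2 * a 2 + y 3 * a 3) * (b 1 - b 2)
      + (y 1 * b 1 + y 2 * b 2 + y 3 * b 3) * (a 2 - a 1) + (y 1 + y 2 + y 3) * (a 1 * b 2 - a 2 * b 1))"
    unfolding d by (simp add: algebra_simps)
  ultimately have "y 1 * d = 0" "y 2 * d = 0" "y 3 * d = 0"
    unfolding e by simp_all
  then have "y 1 = 0" "y 2 = 0" "y 3 = 0" using d0 by auto
  then have "\<forall>i\<le>3. x i = \<mu> * of_real (lam c i)"
    unfolding all_atMost_3 using y0 by (simp add: y_def)
  then show ?thesis by blast
qed

definition lin_form :: "complex ^ 3 \<Rightarrow> complex ^ 3 \<Rightarrow> complex" where
  "lin_form L v = L $ 1 * v $ 1 + L $ 2 * v $ 2 + L $ 3 * v $ 3"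

lemma lin_form_0: "lin_form L 0 = 0"
  by (simp add: lin_form_def)

lemma lin_form_add: "lin_form L (v + v') = lin_form L v + lin_form L v'"
  by (simp add: lin_form_def algebra_simps)

lemma lin_form_scale: "lin_form L (k *s v) = k * lin_form L v"
  by (simp add: lin_form_def algebra_simps)

lemma lin_form_axis: "lin_form (axis k 1) v = v $ k"
  using exhaust_3[of k] by (auto simp: lin_form_def axis_def)

text \<open>The dual of the uniqueness of the relation: a linear form is determined by its values on the
  basis of the last three control vectors, and the one relation among the four vectors is the only
  obstruction to prescribing all four values. By \<open>lin_form_bezier_proj\<close> below it decides which
  cubic polynomials in the parameter are pullbacks of lines.\<close>

lemma lin_form_interpolates:
  assumes l0: "lam c 0 \<noteq> 0"
    and compat: "(\<Sum>i\<le>3. of_real (lam c i) * r i) = 0"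
  shows "\<exists>L. \<forall>i\<le>3. lin_form L (control_vec c i) = r i"
proof -
  define a b where "a i = complex_of_real (fst (c i))" and "b i = complex_of_real (snd (c i))" for i
  define d where "d = complex_of_real (lam c 0)"
  have d: "d = a 3 * (b 2 - b 1) - b 3 * (a 2 - a 1) + (a 2 * b 1 - a 1 * b 2)"
    by (simp add: d_def a_def b_def lam_def lam3_expand)
  have d0: "d \<noteq> 0" using l0 by (simp add: d_def)
  define p q s where "p = r 1 * (b 3 - b 2) + r 2 * (b 1 - b 3) + r 3 * (b 2 - b 1)"
    and "q = r 1 * (a 2 - a 3) + r 2 * (a 3 - a 1) + r 3 * (a 1 - a 2)"
    and "s = r 1 * (a 3 * b 2 - a 2 * b 3) + r 2 * (a 1 * b 3 - a 3 * b 1)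
           + r 3 * (a 2 * b 1 - a 1 * b 2)"
  define L :: "complex ^ 3" where "L = vector [p / d, q / d, s / d]"
  have Ld: "lin_form L (control_vec c i) * d = p * a i + q * b i + s" for i
    using d0 by (simp add: lin_form_def L_def control_vec_def a_def b_def distrib_right)
  have "lin_form L (control_vec c 1) * d = r 1 * d" "lin_form L (control_vec c 2) * d = r 2 * d"
       "lin_form L (control_vec c 3) * d = r 3 * d"
    unfolding Ld by (simp_all add: d p_def q_def s_def algebra_simps)
  then have v: "lin_form L (control_vec c 1) = r 1" "lin_form L (control_vec c 2) = r 2"
       "lin_form L (control_vec c 3) = r 3"
    using d0 by auto
  have "lin_form L (\<Sum>i\<le>3. of_real (lam c i) *s control_vec c i) = 0"
    by (simp add: lam_control_vec lin_form_0)
  then have "(\<Sum>i\<le>3. of_real (lam c i) * lin_form L (control_vec c i)) = (\<Sum>i\<le>3. of_real (lam c i) * r i)"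
    using compat by (simp add: sum_atMost_3 lin_form_add lin_form_scale)
  then have "d * lin_form L (control_vec c 0) = d * r 0"
    unfolding sum_atMost_3 v d_def by (simp only: add_right_cancel)
  then have "lin_form L (control_vec c 0) = r 0" using d0 by simp
  with v show ?thesis unfolding all_atMost_3 by blast
qed

lemma lin_form_bezier_proj:
  "lin_form L (bezier_proj c w t) =
     (\<Sum>i\<le>3. of_real (bezier_u w i) * lin_form L (control_vec c i) * monom3 i t)"
  unfolding bezier_proj_control_vec
  by (simp add: sum_atMost_3 lin_form_add lin_form_scale mult_ac)

section \<open>Parameters with the same curve point\<close>

text \<open>If the kernel vector lies on the secant through \<open>v(t)\<close> and \<open>v(t')\<close>, its Hankel minors are
  those of a sum of two geometric sequences, and these are the coefficients of the polynomial with
  roots \<open>t\<close> and \<open>t'\<close> times a common factor. The scalar \<open>\<mu>\<close> keeps the statement free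
  of divisions; it enters squared since every \<open>\<phi>\<close> is quadratic in the \<open>\<lambda>\<^sub>i\<close>.\<close>

lemma Phi_secant:
  assumes span: "\<forall>i\<le>3. of_real (bezier_u w i) * (x * monom3 i t + y * monom3 i t')
                        = \<mu> * of_real (lam c i)"
  defines "\<kappa> \<equiv> - of_real (bezier_u w 0 * (bezier_u w 1)\<^sup>2 * (bezier_u w 2)\<^sup>2 * bezier_u w 3)
                    * (x * y * (t - t')\<^sup>2)"
  shows "\<mu>\<^sup>2 * of_real (Phi1 c w) = \<kappa> * ((1 - t) * (1 - t'))"
    and "\<mu>\<^sup>2 * of_real (Phi2 c w) = \<kappa> * (t * t')"
    and "\<mu>\<^sup>2 * of_real (Phi1 c w + Phi2 c w - Phi3 c w) = \<kappa>"
proof -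
  define u l where "u i = complex_of_real (bezier_u w i)" and "l i = complex_of_real (lam c i)" for i
  have l: "\<mu> * l 0 = u 0 * (x * (1 - t) ^ 3 + y * (1 - t') ^ 3)"
      "\<mu> * l 1 = u 1 * (x * ((1 - t)\<^sup>2 * t) + y * ((1 - t')\<^sup>2 * t'))"
      "\<mu> * l 2 = u 2 * (x * ((1 - t) * t\<^sup>2) + y * ((1 - t') * t'\<^sup>2))"
      "\<mu> * l 3 = u 3 * (x * t ^ 3 + y * t' ^ 3)"
    using span unfolding all_atMost_3 by (simp_all add: monom3_simps u_def l_def)
  have k: "\<kappa> = - (u 0 * (u 1)\<^sup>2 * (u 2)\<^sup>2 * u 3) * (x * y * (t - t')\<^sup>2)"
    by (simp add: \<kappa>_def u_def)
  have "\<mu>\<^sup>2 * of_real (Phi1 c w)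
      = (u 0 * u 2 * (\<mu> * l 1)\<^sup>2 - (u 1)\<^sup>2 * (\<mu> * l 0) * (\<mu> * l 2)) * u 2 * u 3"
    by (simp add: Phi1_def phi1_def u_def l_def power2_eq_square algebra_simps)
  also have "\<dots> = \<kappa> * ((1 - t) * (1 - t'))"
    unfolding l k by algebra
  finally show 1: "\<mu>\<^sup>2 * of_real (Phi1 c w) = \<kappa> * ((1 - t) * (1 - t'))" .
  have "\<mu>\<^sup>2 * of_real (Phi2 c w)
      = (u 1 * u 3 * (\<mu> * l 2)\<^sup>2 - (u 2)\<^sup>2 * (\<mu> * l 1) * (\<mu> * l 3)) * u 0 * u 1"
    by (simp add: Phi2_def phi2_def u_def l_def power2_eq_square algebra_simps)
  also have "\<dots> = \<kappa> * (t * t')"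
    unfolding l k by algebra
  finally show 2: "\<mu>\<^sup>2 * of_real (Phi2 c w) = \<kappa> * (t * t')" .
  have "\<mu>\<^sup>2 * of_real (Phi3 c w)
      = (u 1 * u 2 * (\<mu> * l 0) * (\<mu> * l 3) - u 0 * u 3 * (\<mu> * l 1) * (\<mu> * l 2)) * u 1 * u 2"
    by (simp add: Phi3_def phi3_def u_def l_def power2_eq_square algebra_simps)
  also have "\<dots> = - \<kappa> * ((1 - t) * t' + (1 - t') * t)"
    unfolding l k by algebra
  finally have 3: "\<mu>\<^sup>2 * of_real (Phi3 c w) = - \<kappa> * ((1 - t) * t' + (1 - t') * t)" .
  have "\<mu>\<^sup>2 * of_real (Phi1 c w + Phi2 c w - Phi3 c w)
      = \<mu>\<^sup>2 * of_real (Phi1 c w) + \<mu>\<^sup>2 * of_real (Phi2 c w) - \<mu>\<^sup>2 * of_real (Phi3 c w)"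
    by (simp add: algebra_simps)
  also have "\<dots> = \<kappa>"
    unfolding 1 2 3 by (simp add: algebra_simps)
  finally show "\<mu>\<^sup>2 * of_real (Phi1 c w + Phi2 c w - Phi3 c w) = \<kappa>" .
qed

text \<open>A linear relation between two curve points lifts to a multiple of the kernel vector. That
  multiple is not zero, because two distinct points of the monomial curve are linearly independent;
  so the secant formulas apply. A relation with only one nonzero coefficient, that is, a parameter
  with curve point zero, is excluded as well: it would make all three Hankel minors and with them
  the leading coefficient vanish.\<close>

lemma dependent_points_params:
  assumes l0: "lam c 0 \<noteq> 0" and u0: "\<forall>i\<le>3. bezier_u w i \<noteq> 0"
    and lead: "Phi1 c w + Phi2 c w - Phi3 c w \<noteq> 0"
    and dep: "x *s bezier_proj c w t + y *s bezier_proj c w t' = 0"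
    and nt: "t \<noteq> t'" and xy: "x \<noteq> 0 \<or> y \<noteq> 0"
  shows "x \<noteq> 0" and "y \<noteq> 0"
    and "of_real (Phi1 c w) = of_real (Phi1 c w + Phi2 c w - Phi3 c w) * ((1 - t) * (1 - t'))"
    and "of_real (Phi2 c w) = of_real (Phi1 c w + Phi2 c w - Phi3 c w) * (t * t')"
proof -
  have "(\<Sum>i\<le>3. (of_real (bezier_u w i) * (x * monom3 i t + y * monom3 i t')) *s control_vec c i) = 0"
    using dep by (simp add: bezier_proj_control_vec vec_eq_iff sum_atMost_3 algebra_simps)
  from control_vec_relation_unique[OF l0 this] obtain \<mu> where
    \<mu>: "\<forall>i\<le>3. of_real (bezier_u w i) * (x * monom3 i t + y * monom3 i t') = \<mu> * of_real (lam c i)"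
    by blast
  have m0: "\<mu> \<noteq> 0"
  proof
    assume "\<mu> = 0"
    then have "\<forall>i\<le>3. x * monom3 i t + y * monom3 i t' = 0"
      using \<mu> u0 by auto
    then have e: "x * (1 - t) ^ 3 + y * (1 - t') ^ 3 = 0"
        "x * ((1 - t)\<^sup>2 * t) + y * ((1 - t')\<^sup>2 * t') = 0"
        "x * ((1 - t) * t\<^sup>2) + y * ((1 - t') * t'\<^sup>2) = 0" "x * t ^ 3 + y * t' ^ 3 = 0"
      unfolding all_atMost_3 by (simp_all add: monom3_simps)
    (* each pair of neighbouring cubic monomials adds up to a quadratic one, as (1 - t) + t = 1 *)
    have "x * (1 - t)\<^sup>2 + y * (1 - t')\<^sup>2
        = (x * (1 - t) ^ 3 + y * (1 - t') ^ 3) + (x * ((1 - t)\<^sup>2 * t) + y * ((1 - t')\<^sup>2 * t'))"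
      and "x * ((1 - t) * t) + y * ((1 - t') * t')
        = (x * ((1 - t)\<^sup>2 * t) + y * ((1 - t')\<^sup>2 * t')) + (x * ((1 - t) * t\<^sup>2) + y * ((1 - t') * t'\<^sup>2))"
      and "x * t\<^sup>2 + y * t'\<^sup>2
        = (x * ((1 - t) * t\<^sup>2) + y * ((1 - t') * t'\<^sup>2)) + (x * t ^ 3 + y * t' ^ 3)"
      by (simp_all add: algebra_simps power2_eq_square power3_eq_cube)
    then have e2: "x * (1 - t)\<^sup>2 + y * (1 - t')\<^sup>2 = 0" "x * ((1 - t) * t) + y * ((1 - t') * t') = 0"
        "x * t\<^sup>2 + y * t'\<^sup>2 = 0"
      unfolding e by simp_all
    have "x * (1 - t) + y * (1 - t')
        = (x * (1 - t)\<^sup>2 + y * (1 - t')\<^sup>2) + (x * ((1 - t) * t) + y * ((1 - t') * t'))"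
      and "x * t + y * t' = (x * ((1 - t) * t) + y * ((1 - t') * t')) + (x * t\<^sup>2 + y * t'\<^sup>2)"
      by (simp_all add: algebra_simps power2_eq_square)
    then have xt: "x * (1 - t) + y * (1 - t') = 0" "x * t + y * t' = 0"
      unfolding e2 by simp_all
    then have "x + y = 0" by (simp add: algebra_simps)
    then have "y = - x" by (simp add: add_eq_0_iff)
    with xt(2) have "x * (t - t') = 0" by (simp add: algebra_simps)
    then show False using nt xy \<open>y = - x\<close> by auto
  qed
  define \<kappa> where "\<kappa> = - of_real (bezier_u w 0 * (bezier_u w 1)\<^sup>2 * (bezier_u w 2)\<^sup>2 * bezier_u w 3)
                    * (x * y * (t - t')\<^sup>2)"
  note P = Phi_secant[OF \<mu>, folded \<kappa>_def]
  have "\<kappa> \<noteq> 0" using P(3) lead m0 by (metis of_real_eq_0_iff mult_eq_0_iff power_not_zero)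
  then show "x \<noteq> 0" "y \<noteq> 0" unfolding \<kappa>_def by auto
  have "\<mu>\<^sup>2 * of_real (Phi1 c w)
      = \<mu>\<^sup>2 * (of_real (Phi1 c w + Phi2 c w - Phi3 c w) * ((1 - t) * (1 - t')))"
    unfolding P(1) using P(3) by (metis mult.assoc)
  then show "of_real (Phi1 c w) = of_real (Phi1 c w + Phi2 c w - Phi3 c w) * ((1 - t) * (1 - t'))"
    using m0 by simp
  have "\<mu>\<^sup>2 * of_real (Phi2 c w)
      = \<mu>\<^sup>2 * (of_real (Phi1 c w + Phi2 c w - Phi3 c w) * (t * t'))"
    unfolding P(2) using P(3) by (metis mult.assoc)
  then show "of_real (Phi2 c w) = of_real (Phi1 c w + Phi2 c w - Phi3 c w) * (t * t')"
    using m0 by simp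
qed

lemma bezier_proj_nonzero:
  assumes "lam c 0 \<noteq> 0" "\<forall>i\<le>3. bezier_u w i \<noteq> 0" "Phi1 c w + Phi2 c w - Phi3 c w \<noteq> 0"
  shows "bezier_proj c w t \<noteq> 0"
proof
  assume "bezier_proj c w t = 0"
  then have "1 *s bezier_proj c w t + 0 *s bezier_proj c w (t + 1) = 0"
    by (simp add: vec_eq_iff)
  from dependent_points_params(2)[OF assms this] show False by simp
qed

text \<open>The recurrence behind the quadratic: \<open>\<Phi>\<^sub>2, \<Phi>\<^sub>3, \<Phi>\<^sub>1\<close> is a multiple of the cross product of the
  two rows \<open>(m\<^sub>0, m\<^sub>1, m\<^sub>2)\<close> and \<open>(m\<^sub>1, m\<^sub>2, m\<^sub>3)\<close> of the Hankel matrix, hence orthogonal to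
  both.\<close>

lemma lam_recurrence:
  assumes u0: "\<forall>i\<le>3. bezier_u w i \<noteq> 0"
  shows "Phi2 c w * (lam c 0 / bezier_u w 0) + Phi3 c w * (lam c 1 / bezier_u w 1)
           + Phi1 c w * (lam c 2 / bezier_u w 2) = 0"
    and "Phi2 c w * (lam c 1 / bezier_u w 1) + Phi3 c w * (lam c 2 / bezier_u w 2)
           + Phi1 c w * (lam c 3 / bezier_u w 3) = 0"
proof -
  define m where "m i = lam c i / bezier_u w i" for i
  have l: "lam c 0 = bezier_u w 0 * m 0" "lam c 1 = bezier_u w 1 * m 1"
      "lam c 2 = bezier_u w 2 * m 2" "lam c 3 = bezier_u w 3 * m 3"
    using u0 by (simp_all add: m_def)
  show "Phi2 c w * (lam c 0 / bezier_u w 0) + Phi3 c w * (lam c 1 / bezier_u w 1)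
           + Phi1 c w * (lam c 2 / bezier_u w 2) = 0"
    unfolding Phi1_def Phi2_def Phi3_def phi1_def phi2_def phi3_def m_def[symmetric]
    unfolding l by algebra
  show "Phi2 c w * (lam c 1 / bezier_u w 1) + Phi3 c w * (lam c 2 / bezier_u w 2)
           + Phi1 c w * (lam c 3 / bezier_u w 3) = 0"
    unfolding Phi1_def Phi2_def Phi3_def phi1_def phi2_def phi3_def m_def[symmetric]
    unfolding l by algebra
qed

text \<open>A sequence that satisfies a recurrence of order 2 with two distinct finite characteristic roots
  is a combination of the two geometric sequences. The coefficients \<open>x\<close> and \<open>y\<close> are fitted to the
  first two terms, and the recurrence then yields the other two. Finiteness of the roots
  \<open>t/(1-t)\<close> and \<open>t'/(1-t')\<close> is what \<open>\<Phi>\<^sub>1 \<noteq> 0\<close> provides.\<close>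

lemma dependent_points_exist:
  fixes t t' :: complex
  assumes l0: "lam c 0 \<noteq> 0" and u0: "\<forall>i\<le>3. bezier_u w i \<noteq> 0"
    and P1: "of_real (Phi1 c w) = of_real (Phi1 c w + Phi2 c w - Phi3 c w) * ((1 - t) * (1 - t'))"
    and P2: "of_real (Phi2 c w) = of_real (Phi1 c w + Phi2 c w - Phi3 c w) * (t * t')"
    and nt: "t \<noteq> t'" and P1n: "Phi1 c w \<noteq> 0"
  shows "\<exists>x y. (x \<noteq> 0 \<or> y \<noteq> 0) \<and> x *s bezier_proj c w t + y *s bezier_proj c w t' = 0"
proof -
  define m where "m i = complex_of_real (lam c i / bezier_u w i)" for i
  define L where "L = complex_of_real (Phi1 c w + Phi2 c w - Phi3 c w)"
  define s s' where "s = 1 - t" and "s' = 1 - t'"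
  have F1: "of_real (Phi1 c w) = L * (s * s')" and F2: "of_real (Phi2 c w) = L * (t * t')"
    unfolding L_def s_def s'_def by (rule P1, rule P2)
  have "of_real (Phi3 c w) = of_real (Phi1 c w) + of_real (Phi2 c w) - L"
    by (simp add: L_def)
  also have "\<dots> = - L * (s * t' + s' * t)"
    unfolding F1 F2 by (simp add: s_def s'_def algebra_simps)
  finally have F3: "of_real (Phi3 c w) = - L * (s * t' + s' * t)" .
  have n: "L \<noteq> 0" "s \<noteq> 0" "s' \<noteq> 0" using P1n F1 by auto
  have r1: "of_real (Phi2 c w) * m 0 + of_real (Phi3 c w) * m 1 + of_real (Phi1 c w) * m 2 = 0"
    using arg_cong[OF lam_recurrence(1)[OF u0, of c], of complex_of_real] by (simp add: m_def)
  have r2: "of_real (Phi2 c w) * m 1 + of_real (Phi3 c w) * m 2 + of_real (Phi1 c w) * m 3 = 0"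
    using arg_cong[OF lam_recurrence(2)[OF u0, of c], of complex_of_real] by (simp add: m_def)
  have "L * (s * s' * m 2 - ((s * t' + s' * t) * m 1 - t * t' * m 0)) = 0"
    using r1 unfolding F1 F2 F3 by (simp add: algebra_simps)
  then have q1: "s * s' * m 2 = (s * t' + s' * t) * m 1 - t * t' * m 0"
    using n unfolding mult_eq_0_iff right_minus_eq by blast
  have "L * (s * s' * m 3 - ((s * t' + s' * t) * m 2 - t * t' * m 1)) = 0"
    using r2 unfolding F1 F2 F3 by (simp add: algebra_simps)
  then have q2: "s * s' * m 3 = (s * t' + s' * t) * m 2 - t * t' * m 1"
    using n unfolding mult_eq_0_iff right_minus_eq by blast
  (* Cramer's rule for the first two terms, with s * t' - s' * t = t' - t *)
  define x y where "x = (m 0 * t' - m 1 * s') / (s\<^sup>2 * (t' - t))"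
    and "y = (m 0 * t - m 1 * s) / (s'\<^sup>2 * (t - t'))"
  have x: "x * (s\<^sup>2 * (t' - t)) = m 0 * t' - m 1 * s'" using n nt by (simp add: x_def)
  have y: "y * (s'\<^sup>2 * (t - t')) = m 0 * t - m 1 * s" using n nt by (simp add: y_def)
  have ss: "s = 1 - t" "s' = 1 - t'" by (simp_all add: s_def s'_def)
  have "(t' - t) * (x * s ^ 3 + y * s' ^ 3 - m 0)
      = x * (s\<^sup>2 * (t' - t)) * s - y * (s'\<^sup>2 * (t - t')) * s' - (t' - t) * m 0"
    by (simp add: algebra_simps power2_eq_square power3_eq_cube)
  also have "\<dots> = 0" unfolding x y unfolding ss by (simp add: algebra_simps)
  finally have e0: "x * s ^ 3 + y * s' ^ 3 = m 0" using nt by simp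
  have "(t' - t) * (x * (s\<^sup>2 * t) + y * (s'\<^sup>2 * t') - m 1)
      = x * (s\<^sup>2 * (t' - t)) * t - y * (s'\<^sup>2 * (t - t')) * t' - (t' - t) * m 1"
    by (simp add: algebra_simps)
  also have "\<dots> = 0" unfolding x y unfolding ss by (simp add: algebra_simps)
  finally have e1: "x * (s\<^sup>2 * t) + y * (s'\<^sup>2 * t') = m 1" using nt by simp
  have "s * s' * m 2 = s * s' * (x * (s * t\<^sup>2) + y * (s' * t'\<^sup>2))"
    unfolding q1 e0[symmetric] e1[symmetric]
    by (simp add: algebra_simps power2_eq_square power3_eq_cube)
  then have e2: "x * (s * t\<^sup>2) + y * (s' * t'\<^sup>2) = m 2" using n by simp
  have "s * s' * m 3 = s * s' * (x * t ^ 3 + y * t' ^ 3)"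
    unfolding q2 e2[symmetric] e1[symmetric]
    by (simp add: algebra_simps power2_eq_square power3_eq_cube)
  then have e3: "x * t ^ 3 + y * t' ^ 3 = m 3" using n by simp
  have e: "\<forall>i\<le>3. of_real (bezier_u w i) * (x * monom3 i t + y * monom3 i t') = of_real (lam c i)"
    using e0 e1 e2 e3 u0 unfolding all_atMost_3
    by (simp add: monom3_simps m_def s_def s'_def)
  have "x *s bezier_proj c w t + y *s bezier_proj c w t' =
      (\<Sum>i\<le>3. (of_real (bezier_u w i) * (x * monom3 i t + y * monom3 i t')) *s control_vec c i)"
    by (simp add: bezier_proj_control_vec vec_eq_iff sum_atMost_3 algebra_simps)
  also have "\<dots> = (\<Sum>i\<le>3. of_real (lam c i) *s control_vec c i)"
    using e by (intro sum.cong) auto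
  finally have "x *s bezier_proj c w t + y *s bezier_proj c w t' = 0"
    by (simp add: lam_control_vec)
  moreover have "x \<noteq> 0 \<or> y \<noteq> 0"
    using e[rule_format, of 0] l0 by auto
  ultimately show ?thesis by blast
qed

section \<open>The double point\<close>

text \<open>Forms are handled as functions, so that they can be built from products of linear forms
  without computing coefficients each time.\<close>

definition is_cubic_form :: "(complex ^ 3 \<Rightarrow> complex) \<Rightarrow> bool" where
  "is_cubic_form F \<longleftrightarrow> (\<exists>f. \<forall>v. cubic_form f v = F v)"

lemma cubic_form_expand:
  "cubic_form f v = f 0 0 * v$3^3 + f 0 1 * v$2 * v$3^2 + f 0 2 * v$2^2 * v$3 + f 0 3 * v$2^3
    + f 1 0 * v$1 * v$3^2 + f 1 1 * v$1 * v$2 * v$3 + f 1 2 * v$1 * v$2^2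
    + f 2 0 * v$1^2 * v$3 + f 2 1 * v$1^2 * v$2 + f 3 0 * v$1^3"
  by (simp add: cubic_form_def eval_nat_numeral)

lemma is_cubic_form_add:
  assumes "is_cubic_form F" "is_cubic_form G"
  shows "is_cubic_form (\<lambda>v. F v + G v)"
proof -
  obtain f g where "\<forall>v. cubic_form f v = F v" "\<forall>v. cubic_form g v = G v"
    using assms by (auto simp: is_cubic_form_def)
  then have "\<forall>v. cubic_form (\<lambda>i j. f i j + g i j) v = F v + G v"
    by (auto simp: cubic_form_def sum.distrib distrib_right)
  then show ?thesis unfolding is_cubic_form_def by blast
qed

lemma cubic_form_cmult: "cubic_form (\<lambda>i j. k * f i j) v = k * cubic_form f v"
  by (simp add: cubic_form_expand algebra_simps)

lemma is_cubic_form_scale: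
  assumes "is_cubic_form F"
  shows "is_cubic_form (\<lambda>v. k * F v)"
proof -
  obtain f where "\<forall>v. cubic_form f v = F v"
    using assms by (auto simp: is_cubic_form_def)
  then have "\<forall>v. cubic_form (\<lambda>i j. k * f i j) v = k * F v"
    by (metis cubic_form_cmult)
  then show ?thesis unfolding is_cubic_form_def by blast
qed

lemma is_cubic_form_product:
  "is_cubic_form (\<lambda>v. lin_form K v * lin_form L v * lin_form M v)"
proof -
  define f where "f i j = (
     if (i, j) = (0, 0) then K$3 * L$3 * M$3
     else if (i, j) = (0, 1) then K$2 * L$3 * M$3 + K$3 * L$2 * M$3 + K$3 * L$3 * M$2
     else if (i, j) = (0, 2) then K$2 * L$2 * M$3 + K$2 * L$3 * M$2 + K$3 * L$2 * M$2
     else if (i, j) = (0, 3) then K$2 * L$2 * M$2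
     else if (i, j) = (1, 0) then K$1 * L$3 * M$3 + K$3 * L$1 * M$3 + K$3 * L$3 * M$1
     else if (i, j) = (1, 1) then K$1 * L$2 * M$3 + K$1 * L$3 * M$2 + K$2 * L$1 * M$3
       + K$2 * L$3 * M$1 + K$3 * L$1 * M$2 + K$3 * L$2 * M$1
     else if (i, j) = (1, 2) then K$1 * L$2 * M$2 + K$2 * L$1 * M$2 + K$2 * L$2 * M$1
     else if (i, j) = (2, 0) then K$1 * L$1 * M$3 + K$1 * L$3 * M$1 + K$3 * L$1 * M$1
     else if (i, j) = (2, 1) then K$1 * L$1 * M$2 + K$1 * L$2 * M$1 + K$2 * L$1 * M$1
     else K$1 * L$1 * M$1)" for i j :: nat
  have "cubic_form f v = lin_form K v * lin_form L v * lin_form M v" for v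
    unfolding cubic_form_expand lin_form_def f_def
    by (simp add: algebra_simps power2_eq_square power3_eq_cube)
  then show ?thesis unfolding is_cubic_form_def by blast
qed

text \<open>The forms \<open>X\<close> and \<open>Y\<close> with pullbacks \<open>t D(t)\<close> and \<open>(1-t) D(t)\<close> exist because the coefficients of
  these two polynomials are orthogonal to the kernel vector, which is the recurrence. Let \<open>Z\<close> be any
  further form, with pullback \<open>z(t)\<close>, and regard \<open>D\<close> and \<open>z\<close> as binary forms in \<open>(t, 1-t)\<close>. Then
  \<open>Z D(X, Y) - z(X, Y)\<close> pulls back to \<open>z D^2 D - D^3 z = 0\<close>. All its terms have
  degree at least 2 in \<open>(X, Y)\<close>, so it is singular where \<open>X\<close> and \<open>Y\<close> both vanish, as they do at the
  image of a root of \<open>D\<close>.\<close>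

lemma double_point_bezier_proj:
  assumes l0: "lam c 0 \<noteq> 0" and u0: "\<forall>i\<le>3. bezier_u w i \<noteq> 0"
    and P1n: "Phi1 c w \<noteq> 0"
    and nz: "bezier_proj c w \<tau> \<noteq> 0"
    and root: "of_real (Phi1 c w) * \<tau>\<^sup>2 + of_real (Phi3 c w) * \<tau> * (1 - \<tau>)
                 + of_real (Phi2 c w) * (1 - \<tau>)\<^sup>2 = 0"
  shows "double_point c w (bezier_proj c w \<tau>)"
proof -
  define Q where "Q = bezier_proj c w \<tau>"
  define p1 p2 p3 where "p1 = complex_of_real (Phi1 c w)" and "p2 = complex_of_real (Phi2 c w)"
    and "p3 = complex_of_real (Phi3 c w)"
  define D where "D t = p1 * t\<^sup>2 + p3 * t * (1 - t) + p2 * (1 - t)\<^sup>2" for t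
  define u l where "u i = complex_of_real (bezier_u w i)" and "l i = complex_of_real (lam c i)" for i
  have un: "u 0 \<noteq> 0" "u 1 \<noteq> 0" "u 2 \<noteq> 0" "u 3 \<noteq> 0" using u0 by (auto simp: u_def)
  have rec: "p2 * (l 0 / u 0) + p3 * (l 1 / u 1) + p1 * (l 2 / u 2) = 0"
      "p2 * (l 1 / u 1) + p3 * (l 2 / u 2) + p1 * (l 3 / u 3) = 0"
    using lam_recurrence[OF u0, of c, THEN arg_cong[of _ _ complex_of_real]]
    by (simp_all add: p1_def p2_def p3_def l_def u_def)
  (* t * D and (1 - t) * D in the basis of the four cubic monomials, divided by the u i *)
  define rX rY where "rX i = [0, p2 / u 1, p3 / u 2, p1 / u 3] ! i"
    and "rY i = [p2 / u 0, p3 / u 1, p1 / u 2, 0] ! i" for i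
  have "(\<Sum>i\<le>3. of_real (lam c i) * rX i) = 0" "(\<Sum>i\<le>3. of_real (lam c i) * rY i) = 0"
    using rec by (simp_all add: sum_atMost_3 rX_def rY_def l_def eval_nat_numeral mult.commute)
  then obtain X Y where X: "\<forall>i\<le>3. lin_form X (control_vec c i) = rX i"
      and Y: "\<forall>i\<le>3. lin_form Y (control_vec c i) = rY i"
    using lin_form_interpolates[OF l0] by metis
  have XP: "lin_form X (bezier_proj c w t) = t * D t" for t
    using X un unfolding lin_form_bezier_proj all_atMost_3
    by (simp add: sum_atMost_3 rX_def monom3_simps D_def u_def[symmetric])
       (simp add: algebra_simps power2_eq_square power3_eq_cube)
  have YP: "lin_form Y (bezier_proj c w t) = (1 - t) * D t" for t
    using Y un unfolding lin_form_bezier_proj all_atMost_3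
    by (simp add: sum_atMost_3 rY_def monom3_simps D_def u_def[symmetric])
       (simp add: algebra_simps power2_eq_square power3_eq_cube)
  have "D \<tau> = 0" using root by (simp add: D_def p1_def p2_def p3_def)
  then have XQ: "lin_form X Q = 0" and YQ: "lin_form Y Q = 0"
    by (simp_all add: Q_def XP YP)
  obtain k where k: "Q $ k \<noteq> 0" using nz by (auto simp: Q_def vec_eq_iff)
  define Z :: "complex ^ 3" where "Z = axis k 1"
  have ZQ: "lin_form Z Q \<noteq> 0" using k by (simp add: Z_def lin_form_axis)
  define z where "z i = u i * lin_form Z (control_vec c i)" for i
  have ZP: "lin_form Z (bezier_proj c w t) = (\<Sum>i\<le>3. z i * monom3 i t)" for t
    by (simp add: lin_form_bezier_proj z_def u_def)
  define F where "F v = lin_form Z v * (p1 * (lin_form X v)\<^sup>2 + p3 * lin_form X v * lin_form Y v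
        + p2 * (lin_form Y v)\<^sup>2)
      - (z 0 * lin_form Y v ^ 3 + z 1 * (lin_form Y v)\<^sup>2 * lin_form X v
         + z 2 * lin_form Y v * (lin_form X v)\<^sup>2 + z 3 * lin_form X v ^ 3)" for v
  have "is_cubic_form (\<lambda>v.
      p1 * (lin_form Z v * lin_form X v * lin_form X v) + (p3 * (lin_form Z v * lin_form X v * lin_form Y v)
      + (p2 * (lin_form Z v * lin_form Y v * lin_form Y v)
      + (- z 0 * (lin_form Y v * lin_form Y v * lin_form Y v)
      + (- z 1 * (lin_form Y v * lin_form Y v * lin_form X v)
      + (- z 2 * (lin_form Y v * lin_form X v * lin_form X v)
      + - z 3 * (lin_form X v * lin_form X v * lin_form X v)))))))"
    by (intro is_cubic_form_add is_cubic_form_scale is_cubic_form_product)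
  also have "(\<lambda>v.
      p1 * (lin_form Z v * lin_form X v * lin_form X v) + (p3 * (lin_form Z v * lin_form X v * lin_form Y v)
      + (p2 * (lin_form Z v * lin_form Y v * lin_form Y v)
      + (- z 0 * (lin_form Y v * lin_form Y v * lin_form Y v)
      + (- z 1 * (lin_form Y v * lin_form Y v * lin_form X v)
      + (- z 2 * (lin_form Y v * lin_form X v * lin_form X v)
      + - z 3 * (lin_form X v * lin_form X v * lin_form X v))))))) = F"
    by (rule ext) (simp add: F_def power2_eq_square power3_eq_cube algebra_simps)
  finally obtain f where f: "\<And>v. cubic_form f v = F v"
    by (auto simp: is_cubic_form_def)
  have on_curve: "F (bezier_proj c w t) = 0" for t
    unfolding F_def XP YP ZP sum_atMost_3 monom3_simps
    by (simp add: D_def) algebra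
  (* For the equation to be nonzero, Z must not vanish at Q. A point on the line that joins Q to the
     end point of the curve witnesses this: Y is zero there and X is not. *)
  have "lin_form X (bezier_proj c w 1 + Q) = p1" "lin_form Y (bezier_proj c w 1 + Q) = 0"
      "lin_form Z (bezier_proj c w 1 + Q) = z 3 + lin_form Z Q"
    by (simp_all add: lin_form_add XP YP ZP XQ YQ D_def sum_atMost_3 monom3_simps)
  then have "F (bezier_proj c w 1 + Q) = p1 ^ 3 * lin_form Z Q"
    by (simp add: F_def algebra_simps power2_eq_square power3_eq_cube)
  then have "cubic_form f (bezier_proj c w 1 + Q) \<noteq> 0"
    using ZQ P1n by (simp add: f p1_def)
  then have "\<exists>i j. i + j \<le> 3 \<and> f i j \<noteq> 0"
    unfolding cubic_form_def by (force intro: sum.neutral)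
  then have eq: "cubic_equation c w f"
    by (simp add: cubic_equation_def f on_curve)
  have sing: "((\<lambda>h. cubic_form f (Q + h *s axis j 1)) has_field_derivative 0) (at 0)" for j
  proof -
    define e :: "complex ^ 3" where "e = axis j 1"
    have Fe: "F (Q + h *s e) = h\<^sup>2 * ((lin_form Z Q + h * lin_form Z e)
          * (p1 * (lin_form X e)\<^sup>2 + p3 * lin_form X e * lin_form Y e + p2 * (lin_form Y e)\<^sup>2)
        - h * (z 0 * lin_form Y e ^ 3 + z 1 * (lin_form Y e)\<^sup>2 * lin_form X e
         + z 2 * lin_form Y e * (lin_form X e)\<^sup>2 + z 3 * lin_form X e ^ 3))" for h
      unfolding F_def lin_form_add lin_form_scale XQ YQ
      by (simp add: algebra_simps power2_eq_square power3_eq_cube)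
    show ?thesis
      unfolding f e_def[symmetric] Fe by (auto intro!: derivative_eq_intros)
  qed
  show ?thesis
    unfolding double_point_def using nz eq sing by (auto simp: Q_def)
qed

section \<open>The criterion\<close>

text \<open>Both directions read off the signs from \<open>\<Phi>\<^sub>1 \<Phi>\<^sub>2 = L^2 t\<^sub>1 (1-t\<^sub>1) t\<^sub>2 (1-t\<^sub>2)\<close>. The second root is
  recovered as \<open>t\<^sub>2 = \<Phi>\<^sub>2 / (L t\<^sub>1)\<close>, which shows that it is real in the one direction and that the
  fibre has no third element in the other.\<close>

theorem proposition9:
  fixes c :: "nat \<Rightarrow> real \<times> real" and w :: "nat \<Rightarrow> real"
  assumes nondeg: "nondegenerate c w"
    and no_three_collinear:
      "\<And>i j k. i < j \<Longrightarrow> j < k \<Longrightarrow> k \<le> 3 \<Longrightarrow> \<not> collinear {c i, c j, c k}"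
    and nonzero_weights: "\<And>i. i \<le> 3 \<Longrightarrow> w i \<noteq> 0"
    and finite_params: "Phi1 c w + Phi2 c w - Phi3 c w \<noteq> 0"
  shows "unwanted_singularity c w \<longleftrightarrow> Phi1 c w * Phi2 c w < 0"
proof
  have l0: "lam c 0 \<noteq> 0"
    by (intro lam_0_nonzero no_three_collinear) auto
  have u0: "\<forall>i\<le>3. bezier_u w i \<noteq> 0"
    using nonzero_weights by (simp add: bezier_u_def)
  define L where "L = Phi1 c w + Phi2 c w - Phi3 c w"
  have L0: "L \<noteq> 0" using finite_params by (simp add: L_def)
  note params = dependent_points_params[OF l0 u0 finite_params, folded L_def]
  {
    assume "unwanted_singularity c w"
    then obtain Q t1 t2 where
        fib: "{t. same_point (bezier_proj c w t) Q} = {complex_of_real t1, t2}"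
        and t1: "t1 \<in> {0<..<1}" and t2: "t2 \<notin> complex_of_real ` {0..1}"
      by (auto simp: unwanted_singularity_def)
    have nt: "complex_of_real t1 \<noteq> t2" using t1 t2 by force
    have "same_point (bezier_proj c w t1) Q" "same_point (bezier_proj c w t2) Q"
      using fib by blast+
    then obtain k1 k2 where k: "k1 \<noteq> 0" "bezier_proj c w t1 = k1 *s Q"
        "k2 \<noteq> 0" "bezier_proj c w t2 = k2 *s Q"
      unfolding same_point_def by metis
    have "k2 *s bezier_proj c w t1 + (- k1) *s bezier_proj c w t2 = 0"
      by (simp add: k vec_eq_iff)
    note p = params(3,4)[OF this nt disjI1[OF k(3)]]
    define r where "r = Phi2 c w / (L * t1)"
    have r: "t2 = of_real r"
      using p(2) L0 t1 by (simp add: r_def)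
    have "complex_of_real (Phi1 c w) = of_real (L * ((1 - t1) * (1 - r)))"
        "complex_of_real (Phi2 c w) = of_real (L * (t1 * r))"
      using p unfolding r by simp_all
    then have "Phi1 c w = L * ((1 - t1) * (1 - r))" "Phi2 c w = L * (t1 * r)"
      unfolding of_real_eq_iff .
    then have "Phi1 c w * Phi2 c w = (L\<^sup>2 * t1 * (1 - t1)) * (r * (1 - r))"
      by (simp add: power2_eq_square)
    moreover have "0 < L\<^sup>2 * t1 * (1 - t1)" using L0 t1 by simp
    moreover have "r * (1 - r) < 0"
    proof -
      have "r < 0 \<or> r > 1" using t2 r by force
      then show ?thesis by (auto simp: mult_less_0_iff)
    qed
    ultimately show "Phi1 c w * Phi2 c w < 0" by (simp add: mult_pos_neg)
  }
  {
    assume neg: "Phi1 c w * Phi2 c w < 0"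
    then have P1n: "Phi1 c w \<noteq> 0" by auto
    define g where "g t = Phi1 c w * t\<^sup>2 + Phi3 c w * t * (1 - t) + Phi2 c w * (1 - t)\<^sup>2" for t
    have cont: "continuous_on {0..1} g" unfolding g_def by (intro continuous_intros)
    have ends: "g 0 = Phi2 c w" "g 1 = Phi1 c w" by (simp_all add: g_def)
    have "\<exists>t1\<ge>0. t1 \<le> 1 \<and> g t1 = 0"
      using neg IVT'[of g 0 0 1] IVT2'[of g 1 0 0] cont ends by (force simp: mult_less_0_iff)
    then obtain t1 where "0 \<le> t1" "t1 \<le> 1" and g1: "g t1 = 0" by blast
    moreover have "t1 \<noteq> 0" "t1 \<noteq> 1" using g1 ends neg by auto
    ultimately have t1: "0 < t1" "t1 < 1" by auto
    define t2 where "t2 = Phi2 c w / (L * t1)"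
    have P2: "Phi2 c w = L * (t1 * t2)" using t1 L0 by (simp add: t2_def)
    have "t1 * (Phi1 c w - L * ((1 - t1) * (1 - t2))) = 0"
      using g1 P2 unfolding g_def L_def by algebra
    then have P1: "Phi1 c w = L * ((1 - t1) * (1 - t2))" using t1 by simp
    have "Phi1 c w * Phi2 c w = (L\<^sup>2 * t1 * (1 - t1)) * (t2 * (1 - t2))"
      unfolding P1 P2 by (simp add: power2_eq_square)
    moreover have "0 < L\<^sup>2 * t1 * (1 - t1)" using L0 t1 by simp
    ultimately have "t2 * (1 - t2) < 0" using neg by (metis mult_less_0_iff not_less_iff_gr_or_eq)
    then have t2: "t2 < 0 \<or> 1 < t2" by (auto simp: mult_less_0_iff)
    have nt: "complex_of_real t1 \<noteq> of_real t2" using t1 t2 by auto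
    have P1c: "of_real (Phi1 c w) = of_real L * ((1 - complex_of_real t1) * (1 - of_real t2))"
      and P2c: "of_real (Phi2 c w) = of_real L * (complex_of_real t1 * of_real t2)"
      by (simp_all add: P1 P2)
    define Q where "Q = bezier_proj c w (of_real t1)"
    have Q0: "Q \<noteq> 0" unfolding Q_def by (rule bezier_proj_nonzero[OF l0 u0 finite_params])
    have "double_point c w Q" unfolding Q_def
    proof (rule double_point_bezier_proj[OF l0 u0])
      show "Phi1 c w \<noteq> 0" by (fact P1n)
      show "bezier_proj c w (of_real t1) \<noteq> 0" using Q0 by (simp add: Q_def)
      show "of_real (Phi1 c w) * (of_real t1)\<^sup>2 + of_real (Phi3 c w) * of_real t1 * (1 - of_real t1)
          + of_real (Phi2 c w) * (1 - of_real t1)\<^sup>2 = (0::complex)"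
        using arg_cong[OF g1, of complex_of_real] by (simp add: g_def)
    qed
    moreover have "{t. same_point (bezier_proj c w t) Q} = {complex_of_real t1, of_real t2}"
    proof (intro set_eqI iffI)
      fix t assume "t \<in> {t. same_point (bezier_proj c w t) Q}"
      then obtain k where k: "k \<noteq> 0" "bezier_proj c w t = k *s Q" by (auto simp: same_point_def)
      show "t \<in> {complex_of_real t1, of_real t2}"
      proof (cases "t = of_real t1")
        case False
        (* any parameter of Q other than t1 satisfies the equation that determines t2 *)
        have "(-1) *s bezier_proj c w t + k *s bezier_proj c w (of_real t1) = 0"
          using k by (simp add: Q_def vec_eq_iff)
        from params(4)[OF this False] have "of_real (Phi2 c w) = of_real L * (t * of_real t1)" by simp
        then show ?thesis using P2c L0 t1 by simp
      qed simp
    next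
      fix t assume "t \<in> {complex_of_real t1, of_real t2}"
      moreover have "same_point Q Q" unfolding same_point_def by (intro exI[of _ 1]) (simp add: vec_eq_iff)
      moreover have "same_point (bezier_proj c w (of_real t2)) Q"
      proof -
        obtain x y where xy: "x \<noteq> 0 \<or> y \<noteq> 0"
            "x *s Q + y *s bezier_proj c w (of_real t2) = 0"
          using dependent_points_exist[OF l0 u0 P1c[unfolded L_def] P2c[unfolded L_def] nt P1n]
          unfolding Q_def by blast
        have n: "x \<noteq> 0" "y \<noteq> 0"
          using params(1,2)[OF xy(2)[unfolded Q_def] nt xy(1)] by auto
        have "bezier_proj c w (of_real t2) = (- x / y) *s Q"
          using xy(2) n by (simp add: vec_eq_iff field_simps add_eq_0_iff)
        then show ?thesis unfolding same_point_def using n by (intro exI[of _ "- x / y"]) simp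
      qed
      ultimately show "t \<in> {t. same_point (bezier_proj c w t) Q}" by (auto simp: Q_def)
    qed
    moreover have "complex_of_real t2 \<notin> complex_of_real ` {0..1}" using t2 by auto
    ultimately show "unwanted_singularity c w"
      unfolding unwanted_singularity_def using t1 by (intro exI[of _ Q] exI[of _ t1]) auto
  }
qed

end
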